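(* Let $d\ge 2$, let $\hat K\subset\mathbb{R}^{d-1}$ be the reference simplex, and let $K\subset\mathbb{R}^d$ be any surface simplex, i.e. a $(d-1)$-dimensional simplex in $\mathbb{R}^d$. Let $\mathbb{M}_K\in\mathbb{R}^{d\times d}$ be a symmetric positive definite matrix (constant metric on $K$), let $F_K:\hat K\to K$ be the affine mapping between them, and $F_K'\in\mathbb{R}^{d\times(d-1)}$ its Jacobian matrix. Then $$\frac{|K|_{\mathbb{M}_K}}{|\hat K|}=\det\left((F_K')^T\mathbb{M}_KF_K'\right)^{1/2},$$ where $|K|_{\mathbb{M}_K}$ denotes the area of $K$ in the metric $\mathbb{M}_K$ and $|\hat K|$ the volume of $\hat K$.
   Context: The reference element $\hat K$ is a fixed nondegenerate equilateral $(d-1)$-simplex in $\mathbb{R}^{d-1}$ with vertices $\xi_1,\dots,\xi_d$. If $x_1^K,\dots,x_d^K\in\mathbb{R}^d$ are the vertices of $K$, then $F_K$ is the affine map with $F_K(\xi_j)=x_j^K$ for $j=1,\dots,d$. In the paper $\mathbb{M}_K$ is the average over $K$ of a symmetric, uniformly positive definite metric tensor $\mathbb{M}(x)$. The metric $\mathbb{M}_K$ induces the norm $\|x\|_{\mathbb{M}_K}=\sqrt{x^T\mathbb{M}_Kx}=\|\mathbb{M}_K^{1/2}x\|$, so geometric properties of $K$ in the metric $\mathbb{M}_K$ are those of $\mathbb{M}_K^{1/2}K$ in the Euclidean metric; in particular $|K|_{\mathbb{M}_K}$ is the Euclidean $(d-1)$-dimensional area of $\mathbb{M}_K^{1/2}K$.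 *)

theory Defs
  imports "HOL-Analysis.Analysis"
begin

text \<open>
  The vertices of a simplex are a family over a finite index type. The family has to be injective
  and its range affinely independent, so the simplex is nondegenerate of dimension
  (number of vertices) - 1.
\<close>
definition simplex_with_vertices :: "('i::finite \<Rightarrow> 'a::euclidean_space) \<Rightarrow> 'a set \<Rightarrow> bool"
  where "simplex_with_vertices v S \<longleftrightarrow>
    inj v \<and> \<not> affine_dependent (range v) \<and> S = convex hull (range v)"

definition equilateral :: "('i \<Rightarrow> 'a::metric_space) \<Rightarrow> bool"
  where "equilateral v \<longleftrightarrow> (\<exists>s>0. \<forall>i j. i \<noteq> j \<longrightarrow> dist (v i) (v j) = s)"

definition affine_map :: "('a::real_vector \<Rightarrow> 'b::real_vector) \<Rightarrow> bool"
  where "affine_map f \<longleftrightarrow> (\<exists>c L. linear L \<and> f = (\<lambda>y. c + L y))"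

definition spd_matrix :: "real^'n^'n \<Rightarrow> bool"
  where "spd_matrix A \<longleftrightarrow> transpose A = A \<and> (\<forall>x. x \<noteq> 0 \<longrightarrow> x \<bullet> (A *v x) > 0)"

text \<open>The principal square root of a symmetric positive definite matrix.\<close>
definition matrix_sqrt :: "real^'n^'n \<Rightarrow> real^'n^'n"
  where "matrix_sqrt A = (THE B. spd_matrix B \<and> B ** B = A)"

definition affine_isometry :: "('a::real_normed_vector \<Rightarrow> 'b::real_normed_vector) \<Rightarrow> bool"
  where "affine_isometry f \<longleftrightarrow> affine_map f \<and> (\<forall>x y. dist (f x) (f y) = dist x y)"

text \<open>
  The Euclidean \<open>CARD('m)\<close>-dimensional area of a set lying in a \<open>CARD('m)\<close>-dimensional affine
  subspace is its Lebesgue measure after isometric identification of that subspace with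
  \<open>real^'m\<close>. It does not depend on the identification, see \<open>flat_area_eq\<close> below. The first
  argument only carries the dimension.
\<close>
definition flat_area :: "'m::finite itself \<Rightarrow> 'a::euclidean_space set \<Rightarrow> real"
  where "flat_area m S =
    measure lebesgue ((SOME f :: real^'m \<Rightarrow> 'a. affine_isometry f \<and> S \<subseteq> range f) -` S)"

text \<open>Area of \<open>S\<close> in the constant metric \<open>M\<close>.\<close>
definition metric_area :: "'m::finite itself \<Rightarrow> real^'n^'n \<Rightarrow> (real^'n) set \<Rightarrow> real"
  where "metric_area m M S = flat_area m ((\<lambda>x. matrix_sqrt M *v x) ` S)"

lemma affine_range_affine_map:
  assumes "affine_map f" shows "affine (range f)"
proof -
  obtain c L where L: "linear L" and f: "f = (\<lambda>y. c + L y)"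
    using assms by (auto simp: affine_map_def)
  have "range f = (+) c ` range L" by (auto simp: f)
  then show ?thesis
    using L by (simp add: linear_subspace_image subspace_imp_affine flip: affine_translation)
qed

lemma affine_vimage_affine_map:
  assumes "affine_map f" "affine S" shows "affine (f -` S)"
proof -
  obtain c L where L: "linear L" and f: "f = (\<lambda>y. c + L y)"
    using assms by (auto simp: affine_map_def)
  show ?thesis
    unfolding affine_def
  proof (intro ballI allI impI)
    fix x y and u v :: real
    assume xy: "x \<in> f -` S" "y \<in> f -` S" and uv: "u + v = 1"
    have "f (u *\<^sub>R x + v *\<^sub>R y) = (u + v) *\<^sub>R c + (u *\<^sub>R L x + v *\<^sub>R L y)"
      using L uv by (simp add: f linear_add linear_scale)
    also have "\<dots> = u *\<^sub>R f x + v *\<^sub>R f y"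
      by (simp add: f algebra_simps)
    finally show "u *\<^sub>R x + v *\<^sub>R y \<in> f -` S"
      using xy uv \<open>affine S\<close> by (auto simp: affine_def)
  qed
qed

lemma negligible_proper_affine:
  fixes S :: "'a::euclidean_space set"
  assumes "affine S" "S \<noteq> UNIV" shows "negligible S"
  using assms affine_hull_nonempty_interior[of S]
  by (auto simp: negligible_convex_interior affine_imp_convex hull_same)

lemma emeasure_lborel_orthogonal_vimage:
  fixes f :: "'a::euclidean_space \<Rightarrow> 'a"
  assumes f: "orthogonal_transformation f" and S: "S \<in> sets borel"
  shows "emeasure lborel (f -` S) = emeasure lborel S"
proof -
  define B where "B = (ball 0 1 :: 'a set)"
  define h where "h = inv f"
  have lin: "linear f" using f by (simp add: orthogonal_transformation_linear)
  have fh: "f (h x) = x" for x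
    using orthogonal_transformation_surj[OF f] by (simp add: h_def surj_f_inv_f)
  have [measurable]: "f \<in> borel_measurable borel"
    using lin by (intro borel_measurable_continuous_onI linear_continuous_on)
      (simp add: linear_conv_bounded_linear)
  have [measurable]: "S \<in> sets borel" "B \<in> sets borel"
    using S by (auto simp: B_def)
  have fB: "f y \<in> B \<longleftrightarrow> y \<in> B" for y
    using f by (simp add: B_def orthogonal_transformation_norm)
  have shift: "(\<integral>\<^sup>+ z. g (c + z) \<partial>lborel) = (\<integral>\<^sup>+ z. g z \<partial>lborel)"
    if [measurable]: "g \<in> borel_measurable borel" for g :: "'a \<Rightarrow> ennreal" and c
    by (subst (2) lborel_distr_plus[of c, symmetric]) (simp add: nn_integral_distr)
  have vol_minus: "(\<integral>\<^sup>+ x. indicator B (c - x) \<partial>lborel) = emeasure lborel B" for c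
  proof -
    have "(\<integral>\<^sup>+ x. indicator B (c - x) \<partial>lborel) = (\<integral>\<^sup>+ x. indicator B (- c + x) \<partial>lborel)"
      by (intro nn_integral_cong) (simp add: B_def indicator_def norm_minus_commute)
    also have "\<dots> = emeasure lborel B" by (subst shift) auto
    finally show ?thesis .
  qed
  define I where "I = (\<integral>\<^sup>+ x. \<integral>\<^sup>+ y. indicator B (f y) * indicator S (x + f y) \<partial>lborel \<partial>lborel)"
  have "I = (\<integral>\<^sup>+ y. \<integral>\<^sup>+ x. indicator B (f y) * indicator S (x + f y) \<partial>lborel \<partial>lborel)"
    unfolding I_def by (rule lborel_pair.Fubini'[symmetric]) measurable
  also have "\<dots> = (\<integral>\<^sup>+ y. indicator B y * emeasure lborel S \<partial>lborel)"
  proof (rule nn_integral_cong)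
    fix y
    have "(\<integral>\<^sup>+ x. indicator B (f y) * indicator S (x + f y) \<partial>lborel) =
        indicator B y * (\<integral>\<^sup>+ x. indicator S (f y + x) \<partial>lborel)"
      by (subst nn_integral_cmult[symmetric]) (auto simp: fB indicator_def add.commute)
    then show "(\<integral>\<^sup>+ x. indicator B (f y) * indicator S (x + f y) \<partial>lborel) =
        indicator B y * emeasure lborel S"
      by (simp add: shift)
  qed
  also have "\<dots> = emeasure lborel B * emeasure lborel S"
    by (simp add: nn_integral_multc)
  finally have 1: "I = emeasure lborel B * emeasure lborel S" .
  have "I = (\<integral>\<^sup>+ x. \<integral>\<^sup>+ y. indicator B (f y - x) * indicator S (f y) \<partial>lborel \<partial>lborel)"
    unfolding I_def
  proof (rule nn_integral_cong)
    fix x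
    show "(\<integral>\<^sup>+ y. indicator B (f y) * indicator S (x + f y) \<partial>lborel) =
        (\<integral>\<^sup>+ y. indicator B (f y - x) * indicator S (f y) \<partial>lborel)"
      by (subst shift[where c = "h x", symmetric]) (auto simp: linear_add[OF lin] fh)
  qed
  also have "\<dots> = (\<integral>\<^sup>+ y. \<integral>\<^sup>+ x. indicator B (f y - x) * indicator S (f y) \<partial>lborel \<partial>lborel)"
    by (rule lborel_pair.Fubini'[symmetric]) measurable
  also have "\<dots> = (\<integral>\<^sup>+ y. emeasure lborel B * indicator (f -` S) y \<partial>lborel)"
    by (simp add: nn_integral_multc vol_minus indicator_vimage)
  also have "\<dots> = emeasure lborel B * emeasure lborel (f -` S)"
    using measurable_sets_borel[of f borel S] by (simp add: nn_integral_cmult)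
  finally have 2: "I = emeasure lborel B * emeasure lborel (f -` S)" .
  have "emeasure lborel B \<noteq> 0" "emeasure lborel B \<noteq> \<infinity>"
    using content_ball_pos[of 1 "0::'a"] emeasure_lborel_ball_finite[of "0::'a" 1]
    by (auto simp: B_def measure_def)
  then show ?thesis
    using 1 2 by (simp add: ennreal_mult_cancel_left)
qed

lemma affine_isometry_transition:
  fixes f g :: "real^'m \<Rightarrow> 'a::euclidean_space"
  assumes f: "affine_isometry f" and g: "affine_isometry g" and sub: "range f \<subseteq> range g"
  obtains b Q where "orthogonal_transformation Q" "f = (\<lambda>y. g (b + Q y))"
proof -
  define T where "T y = (SOME z. g z = f y)" for y
  have gT: "g (T y) = f y" for y
  proof -
    have "f y \<in> range g" using sub by blast
    then have "\<exists>z. g z = f y" by auto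
    then show ?thesis unfolding T_def by (rule someI_ex)
  qed
  have dT: "dist (T x) (T y) = dist x y" for x y
  proof -
    have "dist (g (T x)) (g (T y)) = dist (T x) (T y)" "dist (f x) (f y) = dist x y"
      using f g by (simp_all only: affine_isometry_def)
    then show ?thesis by (simp only: gT)
  qed
  define Q where "Q y = T y - T 0" for y
  have "orthogonal_transformation Q"
    unfolding orthogonal_transformation_isometry
  proof (intro conjI allI)
    show "Q 0 = 0" by (simp only: Q_def diff_self)
    fix x y
    have "dist (Q x) (Q y) = dist (T x) (T y)" by (simp add: Q_def dist_norm)
    then show "dist (Q x) (Q y) = dist x y" by (simp only: dT)
  qed
  moreover have "f = (\<lambda>y. g (T 0 + Q y))"
    by (simp add: Q_def gT)
  ultimately show thesis by (rule that)
qed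

lemma affine_isometry_vimage_measure:
  fixes f g :: "real^'m \<Rightarrow> 'a::euclidean_space"
  assumes f: "affine_isometry f" and g: "affine_isometry g"
    and Sf: "S \<subseteq> range f" and Sg: "S \<subseteq> range g" and meas: "S \<in> sets borel"
  shows "measure lebesgue (f -` S) = measure lebesgue (g -` S)"
proof -
  have neg: "negligible (h -` S)"
    if "affine_isometry h" "affine_isometry k" "S \<subseteq> range k" "\<not> range h \<subseteq> range k"
    for h k :: "real^'m \<Rightarrow> 'a"
  proof -
    have "affine (h -` range k)"
      using that by (simp add: affine_isometry_def affine_range_affine_map affine_vimage_affine_map)
    moreover have "h -` range k \<noteq> UNIV" using that(4) by blast
    ultimately have "negligible (h -` range k)" by (rule negligible_proper_affine)
    then show ?thesis by (rule negligible_subset) (use that(3) in blast)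
  qed
  have onto: "range h = range k"
    if t: "affine_isometry h" "affine_isometry k" "range h \<subseteq> range k" for h k :: "real^'m \<Rightarrow> 'a"
  proof -
    obtain b Q where Q: "orthogonal_transformation Q" and h: "h = (\<lambda>y. k (b + Q y))"
      using affine_isometry_transition[OF t] .
    have "k z \<in> range h" for z
    proof -
      obtain y where "Q y = z - b" using orthogonal_transformation_surj[OF Q] by (metis surjD)
      then have "h y = k z" by (simp add: h)
      then show ?thesis by (metis rangeI)
    qed
    then show ?thesis using t(3) by blast
  qed
  show ?thesis
  proof (cases "range f \<subseteq> range g")
    case True
    obtain b Q where Q: "orthogonal_transformation Q" and fg: "f = (\<lambda>y. g (b + Q y))"
      using affine_isometry_transition[OF f g True] .
    have [measurable]: "g \<in> borel_measurable borel"
    proof (rule borel_measurable_continuous_onI)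
      show "continuous_on UNIV g"
        using g unfolding continuous_on_iff affine_isometry_def by auto
    qed
    have gS: "g -` S \<in> sets borel"
      using measurable_sets_borel[of g borel S] meas by simp
    have QS: "Q -` ((+) b -` (g -` S)) = f -` S" by (auto simp: fg)
    have bS: "(+) b -` (g -` S) \<in> sets borel"
      using measurable_sets_borel[of "(+) b" borel "g -` S"] gS by simp
    have "emeasure lborel (f -` S) = emeasure lborel ((+) b -` (g -` S))"
      using emeasure_lborel_orthogonal_vimage[OF Q bS] by (simp only: QS)
    also have "\<dots> = emeasure (distr lborel borel ((+) b)) (g -` S)"
      using gS by (simp add: emeasure_distr)
    also have "\<dots> = emeasure lborel (g -` S)" by (simp add: lborel_distr_plus)
    finally have e: "emeasure lborel (f -` S) = emeasure lborel (g -` S)" .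
    have [measurable]: "f \<in> borel_measurable borel"
    proof (rule borel_measurable_continuous_onI)
      show "continuous_on UNIV f"
        using f unfolding continuous_on_iff affine_isometry_def by auto
    qed
    have "f -` S \<in> sets borel"
      using measurable_sets_borel[of f borel S] meas by simp
    then have "emeasure lebesgue (f -` S) = emeasure lebesgue (g -` S)"
      using e gS by simp
    then show ?thesis by (simp only: measure_def)
  next
    case False
    then have "\<not> range g \<subseteq> range f" using onto[OF g f] by (metis order_refl)
    then have "negligible (g -` S)" by (rule neg[OF g f Sf])
    moreover have "negligible (f -` S)" by (rule neg[OF f g Sg False])
    ultimately show ?thesis by (simp only: negligible_imp_measure0)
  qed
qed

lemma flat_area_eq:
  fixes f :: "real^'m \<Rightarrow> 'a::euclidean_space"
  assumes "affine_isometry f" "S \<subseteq> range f" "S \<in> sets borel"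
  shows "flat_area TYPE('m) S = measure lebesgue (f -` S)"
proof -
  define g where "g = (SOME f :: real^'m \<Rightarrow> 'a. affine_isometry f \<and> S \<subseteq> range f)"
  have "affine_isometry g \<and> S \<subseteq> range g"
    unfolding g_def by (rule someI[of _ f]) (use assms in blast)
  then have "measure lebesgue (f -` S) = measure lebesgue (g -` S)"
    using affine_isometry_vimage_measure[of f g S] assms by (simp only:)
  then show ?thesis unfolding flat_area_def g_def by (rule sym)
qed

end

theory Submission
  imports Defs
begin

text \<open>
  Write \<open>F z = c + A z\<close>, so that \<open>A\<close> is the Jacobian, and let \<open>Q\<close> be the principal square root
  of \<open>M\<close>. The metric area of \<open>K\<close> is the Euclidean area of \<open>Q K\<close>, the image of the reference simplex
  under \<open>z \<mapsto> Q c + (Q A) z\<close>. The Gram matrix of \<open>B = Q A\<close> is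
  \<open>A\<^sup>T Q\<^sup>T Q A = A\<^sup>T M A\<close>, so everything follows from the area formula
  \<open>flat_area_affine_image\<close>: an injective affine map with linear part \<open>B\<close> multiplies area by
  \<open>sqrt (det (B\<^sup>T B))\<close>.

  For the area formula, diagonalise the Gram matrix, \<open>B\<^sup>T B = U\<^sup>T D U\<close> with \<open>U\<close> orthogonal and \<open>D\<close> a
  positive diagonal matrix, and put \<open>R = D\<^sup>1\<^sup>/\<^sup>2 U\<close>. Then \<open>R\<^sup>T R = B\<^sup>T B\<close>, so \<open>B R\<^sup>-\<^sup>1\<close> has orthonormal columns
  and is an isometric parametrisation of the range of \<open>B\<close>. In this parametrisation the image of
  \<open>S\<close> is \<open>R S\<close>: it arises from \<open>S\<close> by an orthogonal map, which preserves volume, and a coordinatewise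
  scaling, which multiplies volume by \<open>det D\<^sup>1\<^sup>/\<^sup>2\<close>.

  The spectral theorem for symmetric matrices carries all of this. It gives the diagonalisation
  above, and also the existence and uniqueness of the principal square root, without which the
  metric area would be that of an unspecified matrix. Nondegeneracy of the two simplices enters
  twice: it makes \<open>A\<close> injective, hence \<open>B\<^sup>T B\<close> positive definite, and it makes the volume of the
  reference simplex nonzero.
\<close>

section \<open>The spectral theorem for symmetric matrices\<close>

lemma inner_matrix_vector_mult:
  fixes A :: "real^'n^'m"
  shows "x \<bullet> (A *v y) = (transpose A *v x) \<bullet> y"
  using dot_lmul_matrix[of x A y] by simp

text \<open>
  A maximiser \<open>u\<close> of the Rayleigh quotient on the unit sphere of \<open>V\<close> is an eigenvector: if the
  residual \<open>r = A u - l u\<close> were nonzero, moving from \<open>u\<close> in the direction \<open>r\<close> would increase the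
  quotient to first order. The subspace is invariant, so \<open>r\<close> is an admissible direction.
\<close>
lemma symmetric_eigenvector_in_invariant_subspace:
  fixes A :: "real^'n^'n"
  assumes sym: "transpose A = A" and V: "subspace V"
    and inv: "\<And>x. x \<in> V \<Longrightarrow> A *v x \<in> V" and z: "z \<in> V" "z \<noteq> 0"
  obtains u l where "u \<in> V" "norm u = 1" "A *v u = l *\<^sub>R u"
proof -
  have "compact (sphere 0 1 \<inter> V)"
    using closed_subspace[OF V] by (intro compact_Int_closed) auto
  moreover have "z /\<^sub>R norm z \<in> sphere 0 1 \<inter> V"
    using z V by (simp add: subspace_scale)
  moreover have "continuous_on (sphere 0 1 \<inter> V) (\<lambda>x. x \<bullet> (A *v x))"
    by (intro continuous_intros linear_continuous_on) (simp add: linear_linear)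
  ultimately obtain u where u: "u \<in> V" "norm u = 1"
    and max: "\<And>x. x \<in> V \<Longrightarrow> norm x = 1 \<Longrightarrow> x \<bullet> (A *v x) \<le> u \<bullet> (A *v u)"
    using continuous_attains_sup[of "sphere 0 1 \<inter> V" "\<lambda>x. x \<bullet> (A *v x)"] by fastforce
  define l where "l = u \<bullet> (A *v u)"
  define r where "r = A *v u - l *\<^sub>R u"
  have rV: "r \<in> V"
    unfolding r_def using V inv u by (simp add: subspace_diff subspace_scale)
  have bound: "x \<bullet> (A *v x) \<le> l * (x \<bullet> x)" if "x \<in> V" for x
  proof (cases "x = 0")
    case False
    have "x /\<^sub>R norm x \<in> V" "norm (x /\<^sub>R norm x) = 1"
      using False that V by (simp_all add: subspace_scale)
    from max[OF this] have "(x \<bullet> (A *v x)) / (norm x)\<^sup>2 \<le> l"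
      by (simp add: l_def matrix_vector_mult_scaleR power2_eq_square field_simps)
    then show ?thesis
      using False by (simp add: field_simps power2_norm_eq_inner)
  qed simp
  have ur: "u \<bullet> r = 0"
    using u by (simp add: r_def l_def inner_diff_right flip: power2_norm_eq_inner)
  have Ar: "u \<bullet> (A *v r) = r \<bullet> r"
  proof -
    have "u \<bullet> (A *v r) = (A *v u) \<bullet> r" by (simp only: inner_matrix_vector_mult sym)
    also have "A *v u = r + l *\<^sub>R u" by (simp add: r_def)
    finally show ?thesis using ur by (simp add: inner_add_left)
  qed
  have rA: "r \<bullet> (A *v u) = r \<bullet> r"
    using Ar by (metis inner_matrix_vector_mult sym inner_commute)
  define b where "b = l * (r \<bullet> r) - r \<bullet> (A *v r)"
  have b: "b \<ge> 0" using bound[OF rV] by (simp add: b_def)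
  \<comment> \<open>the Rayleigh bound at \<open>u + t r\<close>, expanded in powers of \<open>t\<close>\<close>
  have step: "2 * t * (r \<bullet> r) \<le> t\<^sup>2 * b" for t
  proof -
    have "u + t *\<^sub>R r \<in> V" using u rV V by (simp add: subspace_add subspace_scale)
    from bound[OF this] have "l + 2 * t * (r \<bullet> r) + t\<^sup>2 * (r \<bullet> (A *v r)) \<le> l * (1 + t\<^sup>2 * (r \<bullet> r))"
      using u ur
      by (simp add: matrix_vector_right_distrib matrix_vector_mult_scaleR inner_add_left
          inner_add_right Ar rA inner_commute[of r u] power2_eq_square norm_eq_1
          algebra_simps flip: l_def)
    then show ?thesis by (simp add: b_def algebra_simps)
  qed
  have "r \<bullet> r = 0"
  proof (rule ccontr)
    assume "r \<bullet> r \<noteq> 0"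
    then have p: "r \<bullet> r > 0" by simp
    \<comment> \<open>a step small enough for the linear term to dominate; \<open>+ 1\<close> because \<open>b\<close> may vanish\<close>
    define t where "t = (r \<bullet> r) / (b + 1)"
    have t: "t > 0" using p b by (simp add: t_def)
    have "2 * (r \<bullet> r) \<le> t * b"
      using step[of t] t by (simp add: power2_eq_square)
    also have "\<dots> \<le> t * (b + 1)" using t by simp
    also have "\<dots> = r \<bullet> r" using b by (simp add: t_def)
    finally show False using p by simp
  qed
  then have "A *v u = l *\<^sub>R u" by (simp add: r_def)
  with u show thesis by (rule that)
qed

text \<open>
  An orthonormal set of eigenvectors of largest cardinality is a basis: if it did not span, its
  orthogonal complement would be a nonzero invariant subspace and contain a further eigenvector.
\<close>
lemma symmetric_orthonormal_eigenbasis: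
  fixes A :: "real^'n^'n"
  assumes sym: "transpose A = A"
  obtains E where "pairwise orthogonal E" "card E = CARD('n)" "finite E"
    "\<And>v. v \<in> E \<Longrightarrow> norm v = 1" "\<And>v. v \<in> E \<Longrightarrow> \<exists>l. A *v v = l *\<^sub>R v"
proof -
  define P where "P E \<longleftrightarrow> pairwise orthogonal E \<and> (\<forall>v\<in>E. norm v = 1 \<and> (\<exists>l. A *v v = l *\<^sub>R v))"
    for E :: "(real^'n) set"
  have indep: "independent E" if "P E" for E
    using that by (intro pairwise_orthogonal_independent) (auto simp: P_def)
  have fin: "finite E \<and> card E \<le> CARD('n)" if "P E" for E
    using independent_bound[OF indep[OF that]] by simp
  have "P {}" by (simp add: P_def)
  then obtain E where E: "P E" and max: "\<And>E'. P E' \<Longrightarrow> card E' \<le> card E"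
    using ex_has_greatest_nat[of P "{}" card "CARD('n) + 1"] fin by (auto simp: le_imp_less_Suc)
  have "\<not> card E < CARD('n)"
  proof
    assume "card E < CARD('n)"
    then have "dim E < DIM(real^'n)"
      using dim_eq_card_independent[OF indep[OF E]] by simp
    then obtain z where z: "z \<noteq> 0" "\<And>y. y \<in> span E \<Longrightarrow> orthogonal z y"
      using orthogonal_to_subspace_exists by blast
    have V: "subspace (E\<^sup>\<bottom>)" by (rule subspace_orthogonal_comp)
    have zV: "z \<in> E\<^sup>\<bottom>"
      using z(2) by (auto simp: orthogonal_comp_def orthogonal_commute span_base)
    have inv: "A *v x \<in> E\<^sup>\<bottom>" if "x \<in> E\<^sup>\<bottom>" for x
      unfolding orthogonal_comp_def orthogonal_def
    proof (intro CollectI ballI)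
      fix v assume v: "v \<in> E"
      then obtain l where "A *v v = l *\<^sub>R v" using E by (auto simp: P_def)
      then show "v \<bullet> (A *v x) = 0"
        using that v by (simp add: inner_matrix_vector_mult sym orthogonal_comp_def orthogonal_def)
    qed
    obtain u l where u: "u \<in> E\<^sup>\<bottom>" "norm u = 1" "A *v u = l *\<^sub>R u"
      using symmetric_eigenvector_in_invariant_subspace[OF sym V inv zV z(1)] by blast
    have "P (insert u E)"
      using E u unfolding P_def
      by (auto simp: pairwise_insert orthogonal_comp_def orthogonal_commute)
    moreover have "u \<notin> E" using u by (auto simp: orthogonal_comp_def orthogonal_self)
    ultimately show False using max[of "insert u E"] fin[OF E] by simp
  qed
  with fin[OF E] have "card E = CARD('n)" by simp
  with E fin[OF E] show thesis by (intro that[of E]) (auto simp: P_def)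
qed

definition diag_matrix :: "('n \<Rightarrow> real) \<Rightarrow> real^'n^'n"
  where "diag_matrix d = (\<chi> i j. if i = j then d i else 0)"

lemma diag_matrix_mult_vec [simp]: "(diag_matrix d *v x) $ i = d i * x $ i"
  by (simp add: diag_matrix_def matrix_vector_mult_def if_distrib[of "\<lambda>c. c * _"] cong: if_cong)

lemma transpose_diag_matrix [simp]: "transpose (diag_matrix d) = diag_matrix d"
  by (auto simp: diag_matrix_def transpose_def vec_eq_iff)

lemma diag_matrix_mult: "diag_matrix d ** diag_matrix e = diag_matrix (\<lambda>i. d i * e i)"
  by (simp add: matrix_eq vec_eq_iff flip: matrix_vector_mul_assoc)

lemma det_diag_matrix: "det (diag_matrix d) = (\<Prod>i\<in>UNIV. d i)"
  by (subst det_diagonal) (auto simp: diag_matrix_def)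

text \<open>
  The rows of \<open>U\<close> are an orthonormal eigenbasis, and \<open>U A = D U\<close> says just that each row is an
  eigenvector.
\<close>
theorem spectral_decomposition:
  fixes A :: "real^'n^'n"
  assumes sym: "transpose A = A"
  obtains U d where "orthogonal_matrix U" "A = transpose U ** diag_matrix d ** U"
proof -
  obtain E where E: "pairwise orthogonal E" "card E = CARD('n)" "finite E"
    "\<And>v. v \<in> E \<Longrightarrow> norm v = 1" "\<And>v. v \<in> E \<Longrightarrow> \<exists>l. A *v v = l *\<^sub>R v"
    using symmetric_orthonormal_eigenbasis[OF sym] by blast
  obtain v where v: "bij_betw v (UNIV::'n set) E"
    using finite_same_card_bij[of "UNIV::'n set" E] E by auto
  have vE: "v i \<in> E" for i using v by (auto simp: bij_betw_def)
  then have "\<forall>i. \<exists>l. A *v v i = l *\<^sub>R v i" using E(5) by blast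
  from choice[OF this] obtain d where d: "\<And>i. A *v v i = d i *\<^sub>R v i" by blast
  define U :: "real^'n^'n" where "U = (\<chi> i. v i)"
  have U: "orthogonal_matrix U"
    unfolding orthogonal_matrix_orthonormal_rows
  proof (intro conjI allI impI)
    show "norm (row i U) = 1" for i using E(4)[OF vE] by (simp add: U_def row_def vec_lambda_eta)
    show "orthogonal (row i U) (row j U)" if "i \<noteq> j" for i j
    proof -
      have "v i \<noteq> v j" using v that by (auto simp: bij_betw_def inj_on_def)
      then have "orthogonal (v i) (v j)" using E(1) vE by (simp add: pairwise_def)
      then show ?thesis by (simp add: U_def row_def vec_lambda_eta)
    qed
  qed
  have "U ** A = diag_matrix d ** U"
  proof -
    have "(U *v (A *v x)) $ i = (diag_matrix d *v (U *v x)) $ i" for x i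
    proof -
      have "(U *v (A *v x)) $ i = v i \<bullet> (A *v x)"
        by (simp add: matrix_vector_mul_component U_def)
      also have "\<dots> = d i * (v i \<bullet> x)" by (simp add: inner_matrix_vector_mult sym d)
      also have "v i \<bullet> x = (U *v x) $ i" by (simp add: matrix_vector_mul_component U_def)
      finally show ?thesis by simp
    qed
    then show ?thesis by (simp add: matrix_eq vec_eq_iff flip: matrix_vector_mul_assoc)
  qed
  then have "transpose U ** (U ** A) = transpose U ** (diag_matrix d ** U)" by simp
  then have "A = transpose U ** diag_matrix d ** U"
    using U by (simp add: matrix_mul_assoc orthogonal_matrix_def)
  with U show thesis by (rule that)
qed

lemma spd_decomposition:
  fixes A :: "real^'n^'n"
  assumes "spd_matrix A"
  obtains U d where "orthogonal_matrix U" "\<And>i. d i > 0" "A = transpose U ** diag_matrix d ** U"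
proof -
  obtain U d where U: "orthogonal_matrix U" and A: "A = transpose U ** diag_matrix d ** U"
    using spectral_decomposition[of A] assms by (auto simp: spd_matrix_def)
  have UU: "U ** transpose U = mat 1" using U by (simp add: orthogonal_matrix_def)
  have "d i > 0" for i
  proof -
    \<comment> \<open>the \<open>i\<close>-th row of \<open>U\<close>, an eigenvector for \<open>d i\<close>\<close>
    define w where "w = transpose U *v axis i 1"
    have Uw: "U *v w = axis i 1" by (simp add: w_def matrix_vector_mul_assoc UU del: transpose_matrix_vector)
    then have "w \<noteq> 0" by auto
    then have "0 < w \<bullet> (A *v w)" using assms by (simp add: spd_matrix_def)
    also have "w \<bullet> (A *v w) = (U *v w) \<bullet> (diag_matrix d *v (U *v w))"
      by (simp add: A inner_matrix_vector_mult[of w] del: transpose_matrix_vector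
          flip: matrix_vector_mul_assoc)
    also have "\<dots> = d i" by (simp add: Uw inner_axis')
    finally show ?thesis .
  qed
  with U A show thesis using that by blast
qed

section \<open>The principal square root\<close>

lemma spd_congruence:
  fixes B :: "real^'m^'n"
  assumes "spd_matrix A" and "\<And>v. B *v v = 0 \<Longrightarrow> v = 0"
  shows "spd_matrix (transpose B ** A ** B)"
  unfolding spd_matrix_def
proof (intro conjI allI impI)
  show "transpose (transpose B ** A ** B) = transpose B ** A ** B"
    using assms(1) by (simp add: matrix_transpose_mul spd_matrix_def matrix_mul_assoc)
  fix v :: "real^'m" assume "v \<noteq> 0"
  then have "0 < (B *v v) \<bullet> (A *v (B *v v))" using assms by (auto simp: spd_matrix_def)
  also have "\<dots> = v \<bullet> ((transpose B ** A ** B) *v v)"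
    by (simp add: inner_matrix_vector_mult[of v] del: transpose_matrix_vector
        flip: matrix_vector_mul_assoc)
  finally show "0 < v \<bullet> ((transpose B ** A ** B) *v v)" .
qed

lemma spd_diag_matrix:
  fixes d :: "'n::finite \<Rightarrow> real"
  assumes "\<And>i. d i > 0"
  shows "spd_matrix (diag_matrix d)"
  unfolding spd_matrix_def
proof (intro conjI allI impI)
  fix x :: "real^'n" assume "x \<noteq> 0"
  then obtain i where "x $ i \<noteq> 0" by (auto simp: vec_eq_iff)
  then show "0 < x \<bullet> (diag_matrix d *v x)"
    using assms unfolding inner_vec_def
    by (intro sum_pos2[of _ i])
      (auto simp: less_imp_le mult.left_commute[of _ "d _"] zero_less_mult_iff linorder_neq_iff)
qed simp

text \<open>
  From \<open>B\<^sup>2 = C\<^sup>2\<close> the symmetric matrix \<open>D = B - C\<close> satisfies \<open>B D + D C = B\<^sup>2 - C\<^sup>2 = 0\<close>. Testing this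
  with an eigenvector \<open>w\<close> of \<open>D\<close> on both sides gives \<open>d (w \<bullet> B w + w \<bullet> C w) = 0\<close> for its eigenvalue
  \<open>d\<close>. The bracket is positive, so all eigenvalues of \<open>D\<close> vanish.
\<close>
lemma spd_square_root_unique:
  fixes B C :: "real^'n^'n"
  assumes B: "spd_matrix B" and C: "spd_matrix C" and eq: "B ** B = C ** C"
  shows "B = C"
proof -
  define D where "D = B - C"
  have symD: "transpose D = D"
    using B C by (simp add: D_def spd_matrix_def transpose_def vec_eq_iff)
  obtain U d where U: "orthogonal_matrix U" and D: "D = transpose U ** diag_matrix d ** U"
    using spectral_decomposition[OF symD] .
  have UU: "U ** transpose U = mat 1" using U by (simp add: orthogonal_matrix_def)
  have d0: "d i = 0" for i
  proof -
    define w where "w = transpose U *v axis i 1"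
    have Uw: "U *v w = axis i 1" by (simp add: w_def matrix_vector_mul_assoc UU del: transpose_matrix_vector)
    then have w0: "w \<noteq> 0" by auto
    have "diag_matrix d *v axis i 1 = d i *\<^sub>R axis i 1"
      by (simp add: vec_eq_iff axis_def)
    then have Dw: "D *v w = d i *\<^sub>R w"
      by (simp add: D Uw w_def[symmetric] matrix_vector_mult_scaleR del: transpose_matrix_vector
          flip: matrix_vector_mul_assoc)
    have "B *v (D *v w) + D *v (C *v w) = (B ** B) *v w - (C ** C) *v w"
      by (simp add: D_def matrix_vector_mult_diff_rdistrib matrix_vector_mult_diff_distrib
          flip: matrix_vector_mul_assoc)
    then have "w \<bullet> (B *v (D *v w)) + w \<bullet> (D *v (C *v w)) = 0"
      by (simp add: eq flip: inner_add_right)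
    then have "d i * (w \<bullet> (B *v w) + w \<bullet> (C *v w)) = 0"
      by (simp add: inner_matrix_vector_mult[of w D] symD Dw matrix_vector_mult_scaleR algebra_simps)
    moreover have "w \<bullet> (B *v w) + w \<bullet> (C *v w) > 0"
      using B C w0 by (simp add: spd_matrix_def add_pos_pos)
    ultimately show ?thesis by simp
  qed
  have "D *v x = 0" for x
  proof -
    have "diag_matrix d *v (U *v x) = 0" using d0 by (simp add: vec_eq_iff)
    then show ?thesis by (simp add: D flip: matrix_vector_mul_assoc)
  qed
  then show ?thesis by (simp add: D_def matrix_eq matrix_vector_mult_diff_rdistrib)
qed

text \<open>
  Taking square roots of the eigenvalues gives a square root; by uniqueness it is the matrix
  described by the definition of \<open>matrix_sqrt\<close>.
\<close>
lemma spd_matrix_sqrt: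
  assumes "spd_matrix A"
  shows "spd_matrix (matrix_sqrt A)" "matrix_sqrt A ** matrix_sqrt A = A"
proof -
  obtain U d where U: "orthogonal_matrix U" and d: "\<And>i. d i > 0"
    and A: "A = transpose U ** diag_matrix d ** U"
    using spd_decomposition[OF assms] by blast
  have UU: "U ** transpose U = mat 1" "transpose U ** U = mat 1"
    using U by (simp_all add: orthogonal_matrix_def)
  define B where "B = transpose U ** diag_matrix (\<lambda>i. sqrt (d i)) ** U"
  have "spd_matrix B"
    unfolding B_def
  proof (rule spd_congruence)
    show "spd_matrix (diag_matrix (\<lambda>i. sqrt (d i)))" using d by (intro spd_diag_matrix) simp
    show "v = 0" if "U *v v = 0" for v
    proof -
      have "transpose U *v (U *v v) = 0" by (simp add: that)
      then show ?thesis by (simp add: matrix_vector_mul_assoc UU del: transpose_matrix_vector)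
    qed
  qed
  moreover have "B ** B = A"
  proof -
    have "B ** B = transpose U ** diag_matrix (\<lambda>i. sqrt (d i)) ** (U ** transpose U)
        ** diag_matrix (\<lambda>i. sqrt (d i)) ** U"
      by (simp add: B_def matrix_mul_assoc)
    also have "\<dots> = transpose U ** (diag_matrix (\<lambda>i. sqrt (d i)) ** diag_matrix (\<lambda>i. sqrt (d i))) ** U"
      by (simp add: UU matrix_mul_assoc)
    also have "\<dots> = A"
      using d by (simp add: diag_matrix_mult A less_imp_le)
    finally show ?thesis .
  qed
  ultimately have B: "spd_matrix B \<and> B ** B = A" by simp
  have "spd_matrix (matrix_sqrt A) \<and> matrix_sqrt A ** matrix_sqrt A = A"
    unfolding matrix_sqrt_def
  proof (rule theI[where P = "\<lambda>B. spd_matrix B \<and> B ** B = A" and a = B])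
    show "spd_matrix B \<and> B ** B = A" by (rule B)
    show "C = B" if "spd_matrix C \<and> C ** C = A" for C
      using spd_square_root_unique[of C B] B that by simp
  qed
  then show "spd_matrix (matrix_sqrt A)" "matrix_sqrt A ** matrix_sqrt A = A" by auto
qed

section \<open>Area of a linear image\<close>

text \<open>
  A diagonal matrix scales each coordinate separately, so this is the behaviour of Lebesgue measure
  under coordinatewise scaling. The factor of the Gram matrix that determines the
  area of a linear image is a diagonal matrix times an orthogonal one, so this and the orthogonal
  case below are all that the area formula needs.
\<close>
lemma measure_diag_matrix_image:
  fixes S :: "(real^'n) set"
  assumes d: "\<And>i. d i \<noteq> 0" and S: "compact S"
  shows "measure lebesgue ((\<lambda>x. diag_matrix d *v x) ` S) = (\<Prod>i\<in>UNIV. \<bar>d i\<bar>) * measure lebesgue S"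
proof -
  define c where "c j = (diag_matrix d *v j) \<bullet> j" for j :: "real^'n"
  define T where "T x = diag_matrix d *v x" for x :: "real^'n"
  have c: "c (axis i 1) = d i" for i
    by (simp add: c_def inner_axis)
  have B: "Basis = (\<lambda>i. axis i 1 :: real^'n) ` UNIV" by (auto simp: Basis_vec_def)
  have inj: "inj (\<lambda>i::'n. axis i (1::real))" by (auto simp: inj_on_def axis_eq_axis)
  have T: "T x = 0 + (\<Sum>j\<in>Basis. (c j * (x \<bullet> j)) *\<^sub>R j)" for x
    unfolding B by (subst sum.reindex[OF inj])
      (simp add: T_def c inner_axis vec_eq_iff, simp add: axis_def if_distrib[of "\<lambda>z. _ * z"] cong: if_cong)
  have prod: "(\<Prod>j\<in>Basis. \<bar>c j\<bar>) = (\<Prod>i\<in>UNIV. \<bar>d i\<bar>)"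
    unfolding B by (subst prod.reindex[OF inj]) (simp add: c)
  have injT: "inj T"
    using d by (auto simp: inj_on_def T_def vec_eq_iff)
  have contT: "continuous_on X T" for X
    unfolding T_def by (intro linear_continuous_on) (simp add: linear_linear)
  then have mT [measurable]: "T \<in> borel_measurable borel"
    by (intro borel_measurable_continuous_onI)
  have TS: "compact (T ` S)" using S contT by (rule compact_continuous_image[rotated])
  then have TSb: "T ` S \<in> sets borel" by (simp add: borel_compact)
  have "c j \<noteq> 0" if "j \<in> Basis" for j
    using that d by (auto simp: B c)
  then have "lborel = density (distr lborel borel T) (\<lambda>_. ennreal (\<Prod>j\<in>Basis. \<bar>c j\<bar>))"
    unfolding T[abs_def] by (rule lborel_affine_euclidean)
  then have "emeasure lborel (T ` S) =
      emeasure (density (distr lborel borel T) (\<lambda>_. ennreal (\<Prod>i\<in>UNIV. \<bar>d i\<bar>))) (T ` S)"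
    by (simp add: prod)
  also have "\<dots> = ennreal (\<Prod>i\<in>UNIV. \<bar>d i\<bar>) * emeasure lborel (T -` (T ` S))"
    using TSb by (simp add: emeasure_density_const emeasure_distr)
  also have "T -` (T ` S) = S" using injT by (rule inj_vimage_image_eq)
  finally have "measure lborel (T ` S) = (\<Prod>i\<in>UNIV. \<bar>d i\<bar>) * measure lborel S"
    by (simp add: measure_def enn2real_mult prod_nonneg)
  then show ?thesis
    using S TS by (simp add: T_def[abs_def] borel_compact)
qed

lemma measure_orthogonal_matrix_image:
  fixes S :: "(real^'n) set"
  assumes U: "orthogonal_matrix U" and S: "compact S"
  shows "measure lebesgue ((\<lambda>x. U *v x) ` S) = measure lebesgue S"
proof -
  have orth: "orthogonal_transformation (\<lambda>x. U *v x)"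
    using U by (simp add: orthogonal_transformation_matrix)
  have US: "compact ((\<lambda>x. U *v x) ` S)"
    using S by (intro compact_continuous_image linear_continuous_on) (simp_all add: linear_linear)
  have "(\<lambda>x. U *v x) -` ((\<lambda>x. U *v x) ` S) = S"
    by (rule inj_vimage_image_eq[OF orthogonal_transformation_inj[OF orth]])
  then have "emeasure lborel S = emeasure lborel ((\<lambda>x. U *v x) ` S)"
    using emeasure_lborel_orthogonal_vimage[OF orth borel_compact[OF US]] by simp
  then show ?thesis using S US by (simp add: measure_def borel_compact)
qed

text \<open>
  Here \<open>R = D\<^sup>1\<^sup>/\<^sup>2 U\<close> is a factor of the Gram matrix \<open>U\<^sup>T D U\<close> of \<open>B\<close>, and \<open>R'\<close> is its inverse. Since
  \<open>B R'\<close> preserves norms, \<open>f z = b + B R' z\<close> is an isometric parametrisation with which the area may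
  be computed, and the image of \<open>S\<close> has the coordinates \<open>R S\<close>.
\<close>
lemma flat_area_affine_image:
  fixes B :: "real^'m^'n" and S :: "(real^'m) set"
  assumes inj: "\<And>v. B *v v = 0 \<Longrightarrow> v = 0" and S: "compact S"
  shows "flat_area TYPE('m) ((\<lambda>z. b + B *v z) ` S) =
    sqrt (det (transpose B ** B)) * measure lebesgue S"
proof -
  define G where "G = transpose B ** B"
  have "spd_matrix (mat 1 :: real^'n^'n)" by (auto simp: spd_matrix_def)
  then have "spd_matrix G"
    using spd_congruence[of "mat 1" B] inj by (simp add: G_def)
  then obtain U d where U: "orthogonal_matrix U" and d: "\<And>i. d i > 0"
    and G: "G = transpose U ** diag_matrix d ** U"
    using spd_decomposition by blast
  have UU: "U ** transpose U = mat 1" "transpose U ** U = mat 1"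
    using U by (simp_all add: orthogonal_matrix_def)
  define R where "R = diag_matrix (\<lambda>i. sqrt (d i)) ** U"
  define R' where "R' = transpose U ** diag_matrix (\<lambda>i. 1 / sqrt (d i))"
  have one: "diag_matrix (\<lambda>i. 1) = (mat 1 :: real^'m^'m)"
    by (simp add: diag_matrix_def mat_def)
  have sd: "sqrt (d i) * sqrt (d i) = d i" "sqrt (d i) \<noteq> 0" "d i \<noteq> 0" for i
    using d[of i] by (auto simp: less_imp_le)
  have R'R: "R' ** R = mat 1"
  proof -
    have "R' ** R = transpose U ** (diag_matrix (\<lambda>i. 1 / sqrt (d i)) ** diag_matrix (\<lambda>i. sqrt (d i))) ** U"
      by (simp add: R_def R'_def matrix_mul_assoc)
    then show ?thesis by (simp add: diag_matrix_mult sd one UU)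
  qed
  have R'G: "transpose R' ** G ** R' = mat 1"
  proof -
    have "transpose R' ** G ** R' = diag_matrix (\<lambda>i. 1 / sqrt (d i)) ** (U ** transpose U) **
        diag_matrix d ** (U ** transpose U) ** diag_matrix (\<lambda>i. 1 / sqrt (d i))"
      by (simp add: G R'_def matrix_transpose_mul matrix_mul_assoc)
    also have "\<dots> = diag_matrix (\<lambda>i. (1 / sqrt (d i)) * (d i * (1 / sqrt (d i))))"
      by (simp add: UU diag_matrix_mult flip: matrix_mul_assoc)
    also have "\<dots> = mat 1"
      using d sd by (simp flip: one add: field_simps)
    finally show ?thesis .
  qed
  define f where "f z = b + (B ** R') *v z" for z
  have norm: "norm ((B ** R') *v z) = norm z" for z
  proof -
    have "((B ** R') *v z) \<bullet> ((B ** R') *v z) = ((transpose R' ** G ** R') *v z) \<bullet> z"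
      by (simp add: inner_matrix_vector_mult G_def matrix_transpose_mul matrix_vector_mul_assoc
          matrix_mul_assoc)
    then show ?thesis by (simp add: R'G norm_eq_sqrt_inner)
  qed
  have f: "affine_isometry f"
    unfolding affine_isometry_def affine_map_def
  proof (intro conjI exI allI)
    show "linear (\<lambda>z. (B ** R') *v z)" by simp
    show "f = (\<lambda>y. b + (B ** R') *v y)" by (simp add: f_def[abs_def])
    show "dist (f x) (f y) = dist x y" for x y
      using norm[of "x - y"] by (simp add: f_def dist_norm matrix_vector_mult_diff_distrib)
  qed
  have "inj f"
  proof (rule injI)
    fix x y assume "f x = f y"
    then have "dist (f x) (f y) = 0" by simp
    then show "x = y" using f unfolding affine_isometry_def by (metis dist_eq_0_iff)
  qed
  have img: "(\<lambda>z. b + B *v z) ` S = f ` (\<lambda>z. R *v z) ` S"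
    unfolding image_image f_def
    by (simp add: matrix_vector_mul_assoc R'R flip: matrix_mul_assoc)
  have "compact ((\<lambda>z. b + B *v z) ` S)"
    using S by (intro compact_continuous_image continuous_intros linear_continuous_on)
      (simp_all add: linear_linear)
  then have "flat_area TYPE('m) ((\<lambda>z. b + B *v z) ` S) =
      measure lebesgue (f -` ((\<lambda>z. b + B *v z) ` S))"
    using f by (intro flat_area_eq) (auto simp: img borel_compact)
  also have "f -` ((\<lambda>z. b + B *v z) ` S) = (\<lambda>z. R *v z) ` S"
    unfolding img using \<open>inj f\<close> by (rule inj_vimage_image_eq)
  also have "\<dots> = (\<lambda>z. diag_matrix (\<lambda>i. sqrt (d i)) *v z) ` (\<lambda>z. U *v z) ` S"
    by (simp add: R_def image_image flip: matrix_vector_mul_assoc)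
  also have "measure lebesgue \<dots> = (\<Prod>i\<in>UNIV. sqrt (d i)) * measure lebesgue S"
  proof -
    have "compact ((\<lambda>x. U *v x) ` S)"
      using S by (intro compact_continuous_image linear_continuous_on) (simp_all add: linear_linear)
    then show ?thesis
      using d S U sd by (simp add: measure_diag_matrix_image measure_orthogonal_matrix_image less_imp_le)
  qed
  also have "(\<Prod>i\<in>UNIV. sqrt (d i)) = sqrt (det G)"
  proof -
    have "det G = det (diag_matrix d) * det (transpose U ** U)"
      by (simp add: G det_mul mult_ac)
    also have "\<dots> = (\<Prod>i\<in>UNIV. d i)" by (simp add: UU det_diag_matrix)
    also have "\<dots> = (\<Prod>i\<in>UNIV. sqrt (d i)) * (\<Prod>i\<in>UNIV. sqrt (d i))"
      by (simp only: prod.distrib[symmetric] sd)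
    finally show ?thesis using d by (simp add: prod_nonneg less_imp_le)
  qed
  finally show ?thesis by (simp only: G_def)
qed

section \<open>Nondegenerate simplices\<close>

lemma full_simplex_compact_nonnull:
  fixes v :: "'n::finite \<Rightarrow> real^'m"
  assumes "CARD('n) = CARD('m) + 1" "simplex_with_vertices v S"
  shows "compact S" "measure lebesgue S \<noteq> 0"
proof -
  have v: "inj v" "\<not> affine_dependent (range v)" "S = convex hull (range v)"
    using assms(2) by (auto simp: simplex_with_vertices_def)
  show S: "compact S" by (simp add: v finite_imp_compact_convex_hull)
  have "card (range v) = Suc (DIM(real^'m))"
    using assms(1) v(1) by (simp add: card_image)
  then have "interior S \<noteq> {}"
    using interior_convex_hull_eq_empty v by metis
  then have "\<not> negligible S"
    by (simp add: v negligible_convex_interior)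
  then show "measure lebesgue S \<noteq> 0"
    using S by (simp add: negligible_iff_measure lmeasurable_compact)
qed

text \<open>
  If \<open>A\<close> annihilated some \<open>z \<noteq> 0\<close>, then every \<open>v j\<close> could be projected to the hyperplane orthogonal
  to \<open>z\<close> without changing \<open>A (v j)\<close>. All \<open>x j\<close> would lie in an affine image of that hyperplane,
  whose dimension is too small for so many affinely independent points.
\<close>
lemma linear_part_injective_of_independent_image:
  fixes A :: "real^'m^'n" and v :: "'k::finite \<Rightarrow> real^'m"
  assumes card: "CARD('k) = CARD('m) + 1"
    and x: "inj x" "\<not> affine_dependent (range x)" "\<And>j. x j = c + A *v v j"
    and z: "A *v z = 0"
  shows "z = 0"
proof (rule ccontr)
  assume z0: "z \<noteq> 0"
  define H where "H = {y. z \<bullet> y = 0}"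
  have "range x \<subseteq> (+) c ` ((\<lambda>y. A *v y) ` H)"
  proof
    fix p assume "p \<in> range x"
    then obtain j where j: "p = c + A *v v j" using x(3) by auto
    define y where "y = v j - ((z \<bullet> v j) / (z \<bullet> z)) *\<^sub>R z"
    have "y \<in> H" using z0 by (simp add: H_def y_def inner_diff_right)
    moreover have "A *v y = A *v v j"
      by (simp add: y_def matrix_vector_mult_diff_distrib matrix_vector_mult_scaleR z)
    ultimately show "p \<in> (+) c ` ((\<lambda>y. A *v y) ` H)" unfolding j by (metis imageI)
  qed
  then have "aff_dim (range x) \<le> aff_dim ((+) c ` ((\<lambda>y. A *v y) ` H))" by (rule aff_dim_subset)
  also have "\<dots> \<le> aff_dim H" by (simp add: aff_dim_translation_eq aff_dim_linear_image_le)
  also have "\<dots> = int CARD('m) - 1"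
    using z0 aff_dim_hyperplane[of z 0] by (simp add: H_def)
  finally have "aff_dim (range x) < int CARD('m)" by simp
  moreover have "aff_dim (range x) = int CARD('m)"
    using x(1,2) card by (simp only: affine_independent_iff_card card_image)
  ultimately show False by simp
qed

theorem lemma2p2:
  fixes \<xi> :: "'n::finite \<Rightarrow> real^'m::finite"
    and Khat :: "(real^'m) set"
    and x :: "'n \<Rightarrow> real^'n"
    and K :: "(real^'n) set"
    and M :: "real^'n^'n"
    and F :: "real^'m \<Rightarrow> real^'n"
    and y :: "real^'m"
  assumes "CARD('n) = CARD('m) + 1"
    and "simplex_with_vertices \<xi> Khat" and "equilateral \<xi>"
    and "simplex_with_vertices x K"
    and "spd_matrix M"
    and "affine_map F" and "\<And>j. F (\<xi> j) = x j"
  shows "metric_area TYPE('m) M K / measure lebesgue Khat =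
    sqrt (det (transpose (jacobian F (at y)) ** M ** jacobian F (at y)))"
proof -
  obtain c L where L: "linear L" and F: "F = (\<lambda>y. c + L y)"
    using assms(6) by (auto simp: affine_map_def)
  define A where "A = matrix L"
  have FA: "F z = c + A *v z" for z by (simp add: F A_def matrix_works L)
  have "(F has_derivative L) (at y)"
    unfolding F using L by (auto intro!: derivative_eq_intros linear_imp_has_derivative)
  then have J: "jacobian F (at y) = A"
    using frechet_derivative_at by (metis A_def jacobian_def)
  have injA: "z = 0" if "A *v z = 0" for z
  proof (rule linear_part_injective_of_independent_image[OF assms(1)])
    show "inj x" "\<not> affine_dependent (range x)"
      using assms(4) by (auto simp: simplex_with_vertices_def)
    show "x j = c + A *v \<xi> j" for j using assms(7) FA by metis
  qed (rule that)
  define Q where "Q = matrix_sqrt M"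
  have Q: "spd_matrix Q" "Q ** Q = M" using spd_matrix_sqrt[OF assms(5)] by (simp_all add: Q_def)
  have injQA: "z = 0" if "(Q ** A) *v z = 0" for z
  proof (rule injA, rule ccontr)
    assume "A *v z \<noteq> 0"
    then have "0 < (A *v z) \<bullet> (Q *v (A *v z))" using Q(1) by (simp add: spd_matrix_def)
    with that show False by (simp add: matrix_vector_mul_assoc)
  qed
  have "K = F ` Khat"
  proof -
    have "F ` Khat = (+) c ` L ` (convex hull range \<xi>)"
      using assms(2) by (simp add: simplex_with_vertices_def F image_image)
    also have "\<dots> = convex hull ((+) c ` L ` range \<xi>)"
      by (simp add: convex_hull_linear_image[OF L] convex_hull_translation)
    also have "(+) c ` L ` range \<xi> = range x"
      using assms(7) by (simp add: F image_image)
    finally show ?thesis using assms(4) by (simp add: simplex_with_vertices_def)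
  qed
  then have "(\<lambda>z. Q *v z) ` K = (\<lambda>z. Q *v c + (Q ** A) *v z) ` Khat"
    by (simp add: image_image FA matrix_vector_right_distrib matrix_vector_mul_assoc)
  then have "metric_area TYPE('m) M K =
      sqrt (det (transpose (Q ** A) ** (Q ** A))) * measure lebesgue Khat"
    using flat_area_affine_image[OF injQA full_simplex_compact_nonnull(1)[OF assms(1,2)]]
    by (simp add: metric_area_def Q_def)
  also have "transpose (Q ** A) ** (Q ** A) = transpose A ** M ** A"
    using Q by (simp add: matrix_transpose_mul spd_matrix_def matrix_mul_assoc flip: Q(2))
  finally show ?thesis
    using full_simplex_compact_nonnull(2)[OF assms(1,2)] by (simp add: J)
qed

end
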